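(* Let $m\ge 2$, $n=m(m-1)/2$, and let $(a_1,\dots,a_n)$ be the Mal'cev basis of $UT_m(\mathbb Z)$ consisting of the elements $s_{i,j}$, $1\le i<j\le m$, ordered such that $s_{i,j}$ comes to the left of $s_{k,\ell}$ if and only if $j<\ell$, or $j=\ell$ and $i>k$. Then Nickel's embedding of $UT_m(\mathbb Z)$ with respect to $(a_1,\dots,a_n)$ (the embedding produced by Nickel's algorithm) has dimension $n+1$.
   Context: $UT_m(\mathbb Z)$ is the group of upper triangular $m\times m$ integer matrices with all diagonal entries equal to $1$. For $1\le i<j\le m$, $s_{i,j}=1+e_{i,j}$, where $e_{i,j}$ is the matrix with $(i,j)$ entry $1$ and all other entries $0$. A Mal'cev basis of a finitely generated torsion-free nilpotent group $G$ is a tuple $(a_1,\dots,a_n)$ of elements of $G$ such that every $g\in G$ can be written uniquely as $g=a_1^{x_1}\cdots a_n^{x_n}$ with $x_i\in\mathbb Z$, and such that $G=G_1>G_2>\cdots>G_n>1$ with $G_i=\langle a_i,\dots,a_n\rangle$ is a central series. Nickel's embedding with respect to a Mal'cev basis $(a_1,\dots,a_n)$: $G$ acts on $(\mathbb QG)^*$ (the space of $\mathbb{Q}$-linear maps $\mathbb QG\to\mathbb Q$, identified with functions $G\to\mathbb Q$) by $f^g(h)=f(hg^{-1})$. The coordinate functions are $t_i:G\to\mathbb Z$, $t_i(a_1^{x_1}\cdots a_n^{x_n})=x_i$. The $G$-submodule of $(\mathbb QG)^*$ generated by $t_1,\dots,t_n$ is a finite-dimensional faithful $G$-module, and Nickel's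 embedding is the resulting unitriangular matrix representation of $G$. Its dimension is the dimension over $\mathbb Q$ of this $G$-submodule. *)

theory Defs
  imports "Jordan_Normal_Form.Matrix" "HOL-Algebra.Generated_Groups" "HOL-Library.Function_Algebras"
begin

definition UT :: "nat \<Rightarrow> int mat monoid" where
  "UT m = \<lparr>carrier = {A \<in> carrier_mat m m. upper_triangular A \<and> (\<forall>i<m. A $$ (i, i) = 1)},
           mult = (*), one = 1\<^sub>m m\<rparr>"

text \<open>The indices \<open>i\<close>, \<open>j\<close> run from \<open>1\<close> to \<open>m\<close>, while library matrices are indexed from \<open>0\<close>.\<close>

definition unit_mat :: "nat \<Rightarrow> nat \<Rightarrow> nat \<Rightarrow> int mat" where
  "unit_mat m i j = mat m m (\<lambda>(p, q). if p + 1 = i \<and> q + 1 = j then 1 else 0)"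

definition s_mat :: "nat \<Rightarrow> nat \<Rightarrow> nat \<Rightarrow> int mat" where
  "s_mat m i j = 1\<^sub>m m + unit_mat m i j"

definition power_prod :: "('a, 'b) monoid_scheme \<Rightarrow> 'a list \<Rightarrow> int list \<Rightarrow> 'a" where
  "power_prod G as xs = foldr (\<lambda>(a, x) h. (a [^]\<^bsub>G\<^esub> x) \<otimes>\<^bsub>G\<^esub> h) (zip as xs) \<one>\<^bsub>G\<^esub>"

definition tail_subgroup :: "('a, 'b) monoid_scheme \<Rightarrow> 'a list \<Rightarrow> nat \<Rightarrow> 'a set" where
  "tail_subgroup G as i = generate G (set (drop i as))"

text \<open>A tuple is a list, indexed from \<open>0\<close>; for \<open>i = length as\<close> the tail subgroup is trivial.
  A group with such a tuple is automatically finitely generated, torsion-free and nilpotent, so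
  these properties are not required separately.  Centrality of the series is expressed by
  \<open>[G, G\<^sub>i] \<subseteq> G\<^sub>i\<^sub>+\<^sub>1\<close>.\<close>

definition malcev_basis :: "('a, 'b) monoid_scheme \<Rightarrow> 'a list \<Rightarrow> bool" where
  "malcev_basis G as \<longleftrightarrow>
     group G \<and> set as \<subseteq> carrier G \<and>
     (\<forall>g\<in>carrier G. \<exists>!xs. length xs = length as \<and> g = power_prod G as xs) \<and>
     tail_subgroup G as 0 = carrier G \<and>
     (\<forall>i\<le>length as. tail_subgroup G as i \<lhd> G) \<and>
     (\<forall>i<length as. tail_subgroup G as (Suc i) \<subset> tail_subgroup G as i \<and>
        (\<forall>g\<in>carrier G. \<forall>h\<in>tail_subgroup G as i.
           inv\<^bsub>G\<^esub> g \<otimes>\<^bsub>G\<^esub> inv\<^bsub>G\<^esub> h \<otimes>\<^bsub>G\<^esub> g \<otimes>\<^bsub>G\<^esub> h \<in> tail_subgroup G as (Suc i)))"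

text \<open>The dual of the rational group algebra of \<open>G\<close> is identified with the rational functions on
  \<open>carrier G\<close>; these are represented by the functions on the whole type that vanish
  outside \<open>carrier G\<close>.\<close>

definition rat_scale :: "rat \<Rightarrow> ('a \<Rightarrow> rat) \<Rightarrow> 'a \<Rightarrow> rat" where
  "rat_scale c f = (\<lambda>h. c * f h)"

global_interpretation rat_fun: vector_space rat_scale
  by unfold_locales (auto simp: rat_scale_def fun_eq_iff algebra_simps)

definition dual_space :: "('a, 'b) monoid_scheme \<Rightarrow> ('a \<Rightarrow> rat) set" where
  "dual_space G = {f. \<forall>h. h \<notin> carrier G \<longrightarrow> f h = 0}"

definition dual_act :: "('a, 'b) monoid_scheme \<Rightarrow> ('a \<Rightarrow> rat) \<Rightarrow> 'a \<Rightarrow> 'a \<Rightarrow> rat" where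
  "dual_act G f g = (\<lambda>h. if h \<in> carrier G then f (h \<otimes>\<^bsub>G\<^esub> inv\<^bsub>G\<^esub> g) else 0)"

definition dual_submodule :: "('a, 'b) monoid_scheme \<Rightarrow> ('a \<Rightarrow> rat) set \<Rightarrow> bool" where
  "dual_submodule G V \<longleftrightarrow>
     V \<subseteq> dual_space G \<and> rat_fun.subspace V \<and> (\<forall>g\<in>carrier G. \<forall>f\<in>V. dual_act G f g \<in> V)"

definition malcev_exponents :: "('a, 'b) monoid_scheme \<Rightarrow> 'a list \<Rightarrow> 'a \<Rightarrow> int list" where
  "malcev_exponents G as g = (THE xs. length xs = length as \<and> g = power_prod G as xs)"

definition coord_fun :: "('a, 'b) monoid_scheme \<Rightarrow> 'a list \<Rightarrow> nat \<Rightarrow> 'a \<Rightarrow> rat" where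
  "coord_fun G as i = (\<lambda>g. if g \<in> carrier G then of_int (malcev_exponents G as g ! i) else 0)"

definition nickel_module :: "('a, 'b) monoid_scheme \<Rightarrow> 'a list \<Rightarrow> ('a \<Rightarrow> rat) set" where
  "nickel_module G as = dual_submodule G hull {coord_fun G as i | i. i < length as}"

text \<open>The library's \<open>dim\<close> is \<open>0\<close> on infinite-dimensional spaces, so a positive value
  entails finite dimension.\<close>

definition nickel_dim :: "('a, 'b) monoid_scheme \<Rightarrow> 'a list \<Rightarrow> nat" where
  "nickel_dim G as = rat_fun.dim (nickel_module G as)"

end

theory Submission
  imports Defs "HOL-Algebra.Elementary_Groups" "Jordan_Normal_Form.Determinant"
begin

text \<open>Write \<open>e\<^sub>p\<close> for the matrix unit at position \<open>p\<close>.  The order of the basis is chosen so that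
  \<open>e\<^sub>q e\<^sub>p = 0\<close> when \<open>q\<close> comes after \<open>p\<close>, so the inverse of a product of powers of the basis elements is
  the identity minus the sum of the \<open>x\<^sub>p e\<^sub>p\<close>: the coordinates of \<open>h\<close> are the negated entries of
  \<open>h\<^sup>-\<^sup>1\<close>.  Since \<open>(h g\<^sup>-\<^sup>1)\<^sup>-\<^sup>1 = g h\<^sup>-\<^sup>1\<close>, the action of \<open>g\<close> sends an entry of \<open>h\<^sup>-\<^sup>1\<close> to a linear
  combination of entries in the same column, so the coordinate functions together with the
  constants (the diagonal entries) span the submodule.  The members of the central series are cut
  out by the vanishing of the entries at an initial segment of positions.\<close>

subsection \<open>The group of unitriangular matrices\<close>

lemma UT_simps [simp]:
  "mult (UT m) = (*)" "one (UT m) = 1\<^sub>m m"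
  by (auto simp: UT_def)

lemma mem_UT_iff:
  "A \<in> carrier (UT m) \<longleftrightarrow>
     A \<in> carrier_mat m m \<and> (\<forall>i<m. \<forall>j<i. A $$ (i, j) = 0) \<and> (\<forall>i<m. A $$ (i, i) = 1)"
  by (auto simp: UT_def upper_triangular_def)

lemma UT_carrier_mat: "A \<in> carrier (UT m) \<Longrightarrow> A \<in> carrier_mat m m"
  by (simp add: mem_UT_iff)

lemma UT_lower: "A \<in> carrier (UT m) \<Longrightarrow> j < i \<Longrightarrow> i < m \<Longrightarrow> A $$ (i, j) = 0"
  by (simp add: mem_UT_iff)

lemma UT_diag: "A \<in> carrier (UT m) \<Longrightarrow> i < m \<Longrightarrow> A $$ (i, i) = 1"
  by (simp add: mem_UT_iff)

lemma index_mult_mat_sum: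
  assumes "A \<in> carrier_mat m m" "B \<in> carrier_mat m m" "i < m" "j < m"
  shows "(A * B) $$ (i, j) = (\<Sum>k<m. A $$ (i, k) * B $$ (k, j))"
  using assms by (auto simp: scalar_prod_def atLeast0LessThan)

text \<open>Triangularity kills the terms with \<open>k < i\<close> or \<open>k > j\<close>, and the
  unit diagonals turn \<open>k = i\<close> and \<open>k = j\<close> into single entries. All later
  arguments about the central series concern only the remaining intermediate terms.\<close>

lemma UT_mult_index:
  assumes A: "A \<in> carrier (UT m)" and B: "B \<in> carrier (UT m)" and ij: "i < j" "j < m"
  shows "(A * B) $$ (i, j) = A $$ (i, j) + B $$ (i, j) + (\<Sum>k\<in>{i<..<j}. A $$ (i, k) * B $$ (k, j))"
proof -
  have "(A * B) $$ (i, j) = (\<Sum>k<m. A $$ (i, k) * B $$ (k, j))"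
    using assms by (intro index_mult_mat_sum) (auto simp: UT_carrier_mat)
  also have "\<dots> = (\<Sum>k\<in>insert i (insert j {i<..<j}). A $$ (i, k) * B $$ (k, j))"
  proof (rule sum.mono_neutral_right)
    show "\<forall>k\<in>{..<m} - insert i (insert j {i<..<j}). A $$ (i, k) * B $$ (k, j) = 0"
    proof
      fix k assume "k \<in> {..<m} - insert i (insert j {i<..<j})"
      then have "k < m" "k < i \<or> j < k" by auto
      then show "A $$ (i, k) * B $$ (k, j) = 0"
        using UT_lower[OF A, of k i] UT_lower[OF B, of j k] ij by auto
    qed
  qed (use ij in auto)
  also have "\<dots> = A $$ (i, j) + B $$ (i, j) + (\<Sum>k\<in>{i<..<j}. A $$ (i, k) * B $$ (k, j))"
    using ij UT_diag[OF A, of i] UT_diag[OF B, of j] by simp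
  finally show ?thesis .
qed

lemma UT_mult_closed:
  assumes A: "A \<in> carrier (UT m)" and B: "B \<in> carrier (UT m)"
  shows "A * B \<in> carrier (UT m)"
proof -
  \<comment> \<open>If \<open>k < i\<close>, the first factor lies below the diagonal; otherwise
    \<open>j \<le> i \<le> k\<close> with not all three equal, so \<open>j < k\<close> and the
    second factor does.\<close>
  have z: "A $$ (i, k) * B $$ (k, j) = 0" if "j \<le> i" "i < m" "k < m" "k \<noteq> i \<or> j \<noteq> i" for i j k
    using that UT_lower[OF A, of k i] UT_lower[OF B, of j k] by (cases "k < i") auto
  have "(A * B) $$ (i, j) = 0" if "j < i" "i < m" for i j
    using that z[of j i] A B by (subst index_mult_mat_sum[of _ m]) (auto simp: UT_carrier_mat simp del: mult_eq_0_iff intro!: sum.neutral)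
  moreover have "(A * B) $$ (i, i) = 1" if "i < m" for i
  proof -
    have "(A * B) $$ (i, i) = (\<Sum>k<m. A $$ (i, k) * B $$ (k, i))"
      using that A B by (intro index_mult_mat_sum) (auto simp: UT_carrier_mat)
    also have "\<dots> = (\<Sum>k\<in>{i}. A $$ (i, k) * B $$ (k, i))"
    proof (rule sum.mono_neutral_right)
      show "\<forall>k\<in>{..<m} - {i}. A $$ (i, k) * B $$ (k, i) = 0"
        using z[of i i] that by blast
    qed (use that in auto)
    finally show ?thesis using that A B by (simp add: UT_diag)
  qed
  ultimately show ?thesis
    using assms by (auto simp: mem_UT_iff)
qed

text \<open>Back substitution from the bottom row upwards: in row \<open>i\<close> of
  \<open>A * C\<close> the rows of \<open>C\<close> below \<open>i\<close> are already known to
  vanish in column \<open>j\<close>, and \<open>A\<close> is zero to the left of its diagonal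
  1.\<close>

lemma right_inverse_UT:
  assumes A: "A \<in> carrier (UT m)" and C: "C \<in> carrier_mat m m" and AC: "A * C = 1\<^sub>m m"
  shows "C \<in> carrier (UT m)"
proof -
  have *: "C $$ (i, j) = of_bool (i = j)" if "j \<le> i" "i < m" for i j
    using that
  proof (induction "m - i" arbitrary: i rule: less_induct)
    case less
    have "of_bool (i = j) = (A * C) $$ (i, j)"
      using less.prems by (simp add: AC)
    also have "\<dots> = (\<Sum>k<m. A $$ (i, k) * C $$ (k, j))"
      using less.prems A C by (intro index_mult_mat_sum) (auto simp: UT_carrier_mat)
    also have "\<dots> = (\<Sum>k\<in>{i}. A $$ (i, k) * C $$ (k, j))"
    proof (rule sum.mono_neutral_right)
      show "\<forall>k\<in>{..<m} - {i}. A $$ (i, k) * C $$ (k, j) = 0"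
      proof
        fix k assume k: "k \<in> {..<m} - {i}"
        show "A $$ (i, k) * C $$ (k, j) = 0"
        proof (cases "k < i")
          case True
          then show ?thesis using UT_lower[OF A] less.prems by simp
        next
          case False
          then have "m - k < m - i" "j < k" "k < m" using k less.prems by auto
          then show ?thesis using less.hyps[of k] by simp
        qed
      qed
    qed (use less.prems in auto)
    finally show ?case using UT_diag[OF A] less.prems by simp
  qed
  show ?thesis
    unfolding mem_UT_iff using * C by auto
qed

lemma group_UT: "group (UT m)"
proof (rule groupI)
  show "\<one>\<^bsub>UT m\<^esub> \<in> carrier (UT m)" by (auto simp: mem_UT_iff)
next
  fix A assume A: "A \<in> carrier (UT m)"
  note Am = UT_carrier_mat[OF A]
  \<comment> \<open>Determinant 1 makes the adjugate an inverse with integer entries; its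
    triangularity then comes from back substitution.\<close>
  have "det A = prod_list (diag_mat A)"
    by (rule det_upper_triangular[OF _ Am]) (use A in \<open>auto simp: UT_def\<close>)
  also have "diag_mat A = map (\<lambda>_. 1) [0..<m]"
    using Am UT_diag[OF A] by (auto simp: diag_mat_def)
  finally have "det A = 1" by (simp add: map_replicate_const)
  with adj_mat[OF Am] have inv: "adj_mat A \<in> carrier_mat m m" "A * adj_mat A = 1\<^sub>m m" "adj_mat A * A = 1\<^sub>m m"
    by auto
  with right_inverse_UT[OF A] have "adj_mat A \<in> carrier (UT m)" by blast
  with inv show "\<exists>B\<in>carrier (UT m). B \<otimes>\<^bsub>UT m\<^esub> A = \<one>\<^bsub>UT m\<^esub>" by auto
qed (auto simp: UT_mult_closed dest!: UT_carrier_mat)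

lemma UT_inv_closed: "A \<in> carrier (UT m) \<Longrightarrow> inv\<^bsub>UT m\<^esub> A \<in> carrier (UT m)"
  by (rule group.inv_closed[OF group_UT])

lemma UT_one_closed: "1\<^sub>m m \<in> carrier (UT m)"
  by (auto simp: mem_UT_iff)

lemma UT_inv_one: "inv\<^bsub>UT m\<^esub> 1\<^sub>m m = 1\<^sub>m m"
  using monoid.inv_one[OF group.is_monoid[OF group_UT]] by simp

lemma UT_eqI:
  assumes A: "A \<in> carrier (UT m)" and B: "B \<in> carrier (UT m)"
    and "\<And>i j. i < j \<Longrightarrow> j < m \<Longrightarrow> A $$ (i, j) = B $$ (i, j)"
  shows "A = B"
proof (rule eq_matI)
  fix i j assume "i < dim_row B" "j < dim_col B"
  then have ij: "i < m" "j < m" using UT_carrier_mat[OF B] by auto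
  consider "i < j" | "i = j" | "j < i" by linarith
  then show "A $$ (i, j) = B $$ (i, j)"
    using assms(3)[of i j] ij UT_lower[OF A, of j i] UT_lower[OF B, of j i] UT_diag[OF A, of i] UT_diag[OF B, of i]
    by cases auto
qed (use UT_carrier_mat[OF A] UT_carrier_mat[OF B] in auto)

section \<open>Positions above the diagonal and elementary matrices\<close>

definition strict_upper :: "nat \<Rightarrow> (nat \<times> nat) set" where
  "strict_upper m = {(i, j). i < j \<and> j < m}"

lemma finite_strict_upper: "finite (strict_upper m)"
  by (rule finite_subset[of _ "{..<m} \<times> {..<m}"]) (auto simp: strict_upper_def)

text \<open>Passing from \<open>m\<close> to \<open>Suc m\<close> adds one column, with
  \<open>m\<close> positions above the diagonal.\<close>

lemma card_strict_upper: "card (strict_upper m) = m * (m - 1) div 2"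
proof (induction m)
  case 0
  then show ?case by (simp add: strict_upper_def)
next
  case (Suc m)
  have "strict_upper (Suc m) = strict_upper m \<union> (\<lambda>i. (i, m)) ` {..<m}"
    by (auto simp: strict_upper_def)
  moreover have "strict_upper m \<inter> (\<lambda>i. (i, m)) ` {..<m} = {}"
    by (auto simp: strict_upper_def)
  moreover have "card ((\<lambda>i. (i, m)) ` {..<m}) = m"
    by (subst card_image) (auto simp: inj_on_def)
  ultimately have "card (strict_upper (Suc m)) = m * (m - 1) div 2 + m"
    using Suc by (simp add: card_Un_disjoint finite_strict_upper)
  also have "\<dots> = (m * (m - 1) + m * 2) div 2" by simp
  also have "m * (m - 1) + m * 2 = Suc m * (Suc m - 1)"
    by (cases m) (auto simp: algebra_simps)
  finally show ?case .
qed

text \<open>Indices of matrix entries start from \<open>0\<close> here, hence the shift in \<open>s_mat_Suc\<close>.\<close>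

definition transvection :: "nat \<Rightarrow> nat \<times> nat \<Rightarrow> int \<Rightarrow> int mat" where
  "transvection m p x = mat m m (\<lambda>q. of_bool (fst q = snd q) + x * of_bool (q = p))"

lemma s_mat_Suc: "s_mat m (Suc i) (Suc j) = transvection m (i, j) 1"
  by (rule eq_matI) (auto simp: s_mat_def unit_mat_def transvection_def)

lemma transvection_UT: "p \<in> strict_upper m \<Longrightarrow> transvection m p x \<in> carrier (UT m)"
  by (auto simp: mem_UT_iff transvection_def strict_upper_def)

lemma transvection_index:
  "i < m \<Longrightarrow> j < m \<Longrightarrow> transvection m p x $$ (i, j) = of_bool (i = j) + x * of_bool ((i, j) = p)"
  by (simp add: transvection_def)

lemma transvection_strict_upper:
  "q \<in> strict_upper m \<Longrightarrow> transvection m p x $$ q = x * of_bool (q = p)"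
  by (auto simp: transvection_def strict_upper_def)

lemma transvection_0: "transvection m p 0 = 1\<^sub>m m"
  by (rule eq_matI) (auto simp: transvection_def)

text \<open>Right multiplication by an elementary matrix is a column operation: \<open>x\<close>
  times column \<open>i\<close> is added to column \<open>j\<close>.\<close>

lemma mult_transvection_index:
  assumes A: "A \<in> carrier_mat m m" and "i < m" "j < m" "r < m" "c < m"
  shows "(A * transvection m (i, j) x) $$ (r, c) = A $$ (r, c) + x * A $$ (r, i) * of_bool (c = j)"
proof -
  have "(A * transvection m (i, j) x) $$ (r, c) = (\<Sum>k<m. A $$ (r, k) * transvection m (i, j) x $$ (k, c))"
    using assms by (intro index_mult_mat_sum) (auto simp: transvection_def)
  also have "\<dots> = (\<Sum>k<m. A $$ (r, k) * of_bool (k = c)) + (\<Sum>k<m. x * of_bool (c = j) * A $$ (r, k) * of_bool (k = i))"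
    unfolding sum.distrib[symmetric] using assms by (intro sum.cong) (auto simp: transvection_index algebra_simps)
  also have "\<dots> = A $$ (r, c) + x * A $$ (r, i) * of_bool (c = j)"
    using assms by (auto simp: of_bool_def if_distrib[of "\<lambda>x. _ * x"] sum.delta cong: if_cong)
  finally show ?thesis .
qed

lemma transvection_add:
  assumes "p \<in> strict_upper m"
  shows "transvection m p (x + y) = transvection m p x * transvection m p y"
proof -
  obtain i j where p: "p = (i, j)" and ij: "i < j" "j < m" using assms by (auto simp: strict_upper_def)
  show ?thesis
  proof (rule eq_matI)
    fix r c assume "r < dim_row (transvection m p x * transvection m p y)"
      and "c < dim_col (transvection m p x * transvection m p y)"
    then have "r < m" "c < m" by (auto simp: transvection_def)
    then show "transvection m p (x + y) $$ (r, c) = (transvection m p x * transvection m p y) $$ (r, c)"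
      unfolding p using ij
      by (subst mult_transvection_index) (auto simp: transvection_def algebra_simps)
  qed (auto simp: transvection_def)
qed

text \<open>Additivity in the exponent makes \<open>transvection m p\<close> a homomorphism from the
  integers, which covers negative powers as well.\<close>

lemma transvection_int_pow:
  assumes p: "p \<in> strict_upper m"
  shows "transvection m p 1 [^]\<^bsub>UT m\<^esub> (x :: int) = transvection m p x"
proof -
  have "transvection m p \<in> hom integer_group (UT m)"
    by (auto simp: hom_def transvection_UT[OF p] transvection_add[OF p])
  from hom_int_pow[OF this, of 1 x] show ?thesis by (simp add: group_UT)
qed

subsection \<open>Products of powers of the basis elements\<close>

abbreviation gens :: "nat \<Rightarrow> (nat \<times> nat) list \<Rightarrow> int mat list" where
  "gens m ps \<equiv> map (\<lambda>p. transvection m p 1) ps"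

text \<open>The basis order of the theorem, unaffected by the shift to indices from 0: columns from
  left to right, each column from bottom to top.\<close>

definition prec :: "nat \<times> nat \<Rightarrow> nat \<times> nat \<Rightarrow> bool" where
  "prec p q \<longleftrightarrow> snd p < snd q \<or> snd p = snd q \<and> fst p > fst q"

text \<open>The candidate for the inverse of the power product. Looking entries up in an association
  list gives it a meaning for partial lists of positions, as induction over the list
  requires.\<close>

definition inv_prod_mat :: "nat \<Rightarrow> (nat \<times> nat) list \<Rightarrow> int list \<Rightarrow> int mat" where
  "inv_prod_mat m ps xs =
     mat m m (\<lambda>q. case map_of (zip ps xs) q of None \<Rightarrow> of_bool (fst q = snd q) | Some x \<Rightarrow> - x)"

lemma inv_prod_mat_UT:
  assumes "set ps \<subseteq> strict_upper m"
  shows "inv_prod_mat m ps xs \<in> carrier (UT m)"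
proof -
  have "map_of (zip ps xs) (i, j) = None" if "j \<le> i" for i j
    using that assms by (auto simp: map_of_eq_None_iff strict_upper_def dest: set_zip_leftD)
  then show ?thesis by (auto simp: mem_UT_iff inv_prod_mat_def)
qed

lemma power_prod_UT:
  assumes "set ps \<subseteq> strict_upper m"
  shows "power_prod (UT m) (gens m ps) xs \<in> carrier (UT m)"
  using assms
proof (induction ps arbitrary: xs)
  case (Cons p ps)
  then show ?case
    by (cases xs) (auto simp: power_prod_def transvection_int_pow transvection_UT UT_mult_closed UT_one_closed)
qed (simp add: power_prod_def UT_one_closed)

text \<open>A new first position \<open>p\<close> multiplies the product by \<open>?T x\<close> on
  the left, so the candidate inverse must gain the factor \<open>?T (- x)\<close> on the right. This
  column operation alters only the entry at \<open>p\<close>, and the whole product then collapses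
  from the inside.\<close>

lemma power_prod_mult_inv_prod_mat:
  assumes "set ps \<subseteq> strict_upper m" "sorted_wrt prec ps" "length xs = length ps"
  shows "power_prod (UT m) (gens m ps) xs * inv_prod_mat m ps xs = 1\<^sub>m m"
  using assms
proof (induction ps arbitrary: xs)
  case Nil
  have "inv_prod_mat m [] xs = 1\<^sub>m m"
    by (rule eq_matI) (auto simp: inv_prod_mat_def)
  then show ?case by (simp add: power_prod_def)
next
  case (Cons p ps)
  then obtain x ys where xs: "xs = x # ys" and len: "length ys = length ps" by (cases xs) auto
  have p: "p \<in> strict_upper m" and ps: "set ps \<subseteq> strict_upper m" using Cons.prems by auto
  obtain i j where ij: "p = (i, j)" "i < j" "j < m" using p by (auto simp: strict_upper_def)
  let ?P = "power_prod (UT m) (gens m ps) ys" and ?N = "inv_prod_mat m ps ys"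
  let ?T = "transvection m p"
  have car: "?P \<in> carrier_mat m m" "?N \<in> carrier_mat m m" "?T y \<in> carrier_mat m m" for y
    using power_prod_UT[OF ps] inv_prod_mat_UT[OF ps] transvection_UT[OF p] by (auto simp: UT_carrier_mat)
  \<comment> \<open>Positions after \<open>p = (i, j)\<close> lie in columns from \<open>j\<close>
    on, and \<open>i < j\<close>; hence column \<open>i\<close> of \<open>?N\<close> is still that
    of the identity.\<close>
  have "map_of (zip ps ys) (r, i) = None" for r
    using Cons.prems(2) ij by (auto simp: map_of_eq_None_iff prec_def dest!: set_zip_leftD)
  moreover have "map_of (zip ps ys) p = None"
    using Cons.prems(2) by (auto simp: map_of_eq_None_iff prec_def dest!: set_zip_leftD)
  ultimately have N: "inv_prod_mat m (p # ps) xs = ?N * ?T (- x)"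
  proof (intro eq_matI)
    fix r c assume "r < dim_row (?N * ?T (- x))" "c < dim_col (?N * ?T (- x))"
    then have rc: "r < m" "c < m" using car by (auto simp: transvection_def inv_prod_mat_def)
    have "(?N * ?T (- x)) $$ (r, c) = ?N $$ (r, c) + (- x) * ?N $$ (r, i) * of_bool (c = j)"
      using mult_transvection_index[OF car(2)] rc ij by simp
    also have "\<dots> = inv_prod_mat m (p # ps) xs $$ (r, c)"
      using rc ij \<open>map_of (zip ps ys) (r, i) = None\<close> \<open>map_of (zip ps ys) p = None\<close>
      by (auto simp: inv_prod_mat_def xs)
    finally show "inv_prod_mat m (p # ps) xs $$ (r, c) = (?N * ?T (- x)) $$ (r, c)" ..
  qed (auto simp: inv_prod_mat_def transvection_def)
  have P: "power_prod (UT m) (gens m (p # ps)) xs = ?T x * ?P"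
    by (simp add: xs power_prod_def transvection_int_pow[OF p])
  have "power_prod (UT m) (gens m (p # ps)) xs * inv_prod_mat m (p # ps) xs = ?T x * (?P * ?N) * ?T (- x)"
    unfolding N P using car by (simp add: assoc_mult_mat[of _ m m _ m _ m])
  also have "\<dots> = ?T x * ?T (- x)"
    using Cons.IH[OF ps _ len] Cons.prems(2) right_mult_one_mat[OF car(3)] by simp
  also have "\<dots> = 1\<^sub>m m"
    by (simp add: transvection_add[OF p, symmetric] transvection_0)
  finally show ?case .
qed


lemma sorted_wrt_prec_distinct: "sorted_wrt prec ps \<Longrightarrow> distinct ps"
  by (induction ps) (auto simp: prec_def)

text \<open>This yields existence and uniqueness of exponents together. Inversion is a bijection
  taking the product to \<open>?N\<close>, and unitriangular matrices are equal once they agree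
  above the diagonal, where \<open>?N\<close> carries the negated exponents.\<close>

lemma power_prod_unique:
  assumes ps: "set ps = strict_upper m" "sorted_wrt prec ps" and len: "length xs = length ps"
    and g: "g \<in> carrier (UT m)"
  shows "g = power_prod (UT m) (gens m ps) xs \<longleftrightarrow> xs = map (\<lambda>p. - ((inv\<^bsub>UT m\<^esub> g) $$ p)) ps"
proof -
  interpret group "UT m" by (rule group_UT)
  let ?P = "power_prod (UT m) (gens m ps) xs" and ?N = "inv_prod_mat m ps xs"
  have P: "?P \<in> carrier (UT m)" and N: "?N \<in> carrier (UT m)"
    using power_prod_UT inv_prod_mat_UT ps by auto
  have "?P \<otimes>\<^bsub>UT m\<^esub> ?N = \<one>\<^bsub>UT m\<^esub>"
    using power_prod_mult_inv_prod_mat[of ps m xs] ps len by simp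
  then have inv_N: "inv\<^bsub>UT m\<^esub> ?N = ?P"
    by (rule inv_equality) (fact N P)+
  have nth_N: "?N $$ (ps ! k) = - (xs ! k)" if "k < length ps" for k
  proof -
    have "map_of (zip ps xs) (ps ! k) = Some (xs ! k)"
      using that len sorted_wrt_prec_distinct[OF ps(2)] by (intro map_of_zip_nth) auto
    moreover have "ps ! k \<in> strict_upper m" using that ps by (metis nth_mem)
    ultimately show ?thesis by (cases "ps ! k") (auto simp: inv_prod_mat_def strict_upper_def)
  qed
  have "g = ?P \<longleftrightarrow> inv\<^bsub>UT m\<^esub> g = ?N"
    using inv_N g N by (metis inv_inv)
  also have "\<dots> \<longleftrightarrow> (\<forall>p\<in>set ps. (inv\<^bsub>UT m\<^esub> g) $$ p = ?N $$ p)"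
    using UT_eqI[OF inv_closed[OF g] N] ps(1) by (auto simp: strict_upper_def)
  also have "\<dots> \<longleftrightarrow> (\<forall>k<length ps. (inv\<^bsub>UT m\<^esub> g) $$ (ps ! k) = - (xs ! k))"
    using nth_N by (auto simp: all_set_conv_all_nth)
  also have "\<dots> \<longleftrightarrow> xs = map (\<lambda>p. - ((inv\<^bsub>UT m\<^esub> g) $$ p)) ps"
    using len by (auto simp: list_eq_iff_nth_eq)
  finally show ?thesis .
qed

lemma malcev_exponents_UT:
  assumes "set ps = strict_upper m" "sorted_wrt prec ps" "g \<in> carrier (UT m)"
  shows "malcev_exponents (UT m) (gens m ps) g = map (\<lambda>p. - ((inv\<^bsub>UT m\<^esub> g) $$ p)) ps"
  unfolding malcev_exponents_def
  by (rule the_equality) (use power_prod_unique[OF assms(1,2) _ assms(3)] in auto)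

subsection \<open>The central series\<close>

definition vanish_on :: "nat \<Rightarrow> (nat \<times> nat) set \<Rightarrow> int mat set" where
  "vanish_on m Z = {A \<in> carrier (UT m). \<forall>p\<in>Z. A $$ p = 0}"

text \<open>With \<open>(i, j)\<close> such a set contains all \<open>(k, j)\<close> and
  \<open>(i, k)\<close> with \<open>i < k < j\<close>, that is, the positions met in the
  intermediate terms of entry \<open>(i, j)\<close> of a product.\<close>

definition prec_closed :: "nat \<Rightarrow> (nat \<times> nat) set \<Rightarrow> bool" where
  "prec_closed m Z \<longleftrightarrow> Z \<subseteq> strict_upper m \<and> (\<forall>q\<in>Z. \<forall>p\<in>strict_upper m. prec p q \<longrightarrow> p \<in> Z)"

text \<open>Agreement on \<open>Z\<close> puts two matrices into one left coset. For the quotient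
  \<open>D\<close>, entry \<open>(i, j)\<close> of \<open>A * D = B\<close> involves
  \<open>D\<close> only at \<open>(i, j)\<close> and at positions further down column
  \<open>j\<close>, so induction on the distance to the diagonal applies.\<close>

lemma inv_mult_vanish_on:
  assumes Z: "prec_closed m Z" and A: "A \<in> carrier (UT m)" and B: "B \<in> carrier (UT m)"
    and agree: "\<And>p. p \<in> Z \<Longrightarrow> A $$ p = B $$ p"
  shows "inv\<^bsub>UT m\<^esub> A \<otimes>\<^bsub>UT m\<^esub> B \<in> vanish_on m Z"
proof -
  interpret group "UT m" by (rule group_UT)
  define D where "D = inv\<^bsub>UT m\<^esub> A \<otimes>\<^bsub>UT m\<^esub> B"
  have D: "D \<in> carrier (UT m)" unfolding D_def using A B by (intro m_closed inv_closed)
  have "A \<otimes>\<^bsub>UT m\<^esub> D = B"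
    unfolding D_def using A B by (simp add: m_assoc[symmetric] del: UT_simps)
  then have AD: "A * D = B" by simp
  have "D $$ (i, j) = 0" if "(i, j) \<in> Z" for i j
    using that
  proof (induction "j - i" arbitrary: i rule: less_induct)
    case less
    have ij: "i < j" "j < m" using less.prems Z by (auto simp: prec_closed_def strict_upper_def)
    have "D $$ (k, j) = 0" if "k \<in> {i<..<j}" for k
    proof (rule less.hyps)
      have "(k, j) \<in> strict_upper m" "prec (k, j) (i, j)"
        using that ij by (auto simp: strict_upper_def prec_def)
      with Z less.prems show "(k, j) \<in> Z" unfolding prec_closed_def by blast
    qed (use that in auto)
    then have "B $$ (i, j) = A $$ (i, j) + D $$ (i, j)"
      using UT_mult_index[OF A D ij] by (simp add: AD)
    with agree[OF less.prems] show ?case by simp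
  qed
  with D show ?thesis unfolding vanish_on_def D_def by auto
qed

lemma subgroup_vanish_on:
  assumes Z: "prec_closed m Z"
  shows "subgroup (vanish_on m Z) (UT m)"
proof -
  interpret group "UT m" by (rule group_UT)
  have one: "\<one>\<^bsub>UT m\<^esub> \<in> vanish_on m Z"
    using one_closed Z by (auto simp: vanish_on_def prec_closed_def strict_upper_def)
  show ?thesis
  proof
    fix A assume A: "A \<in> vanish_on m Z"
    \<comment> \<open>Comparing \<open>A\<close> with the identity, both zero on \<open>Z\<close>,
      gives closure under inverses.\<close>
    then have "inv\<^bsub>UT m\<^esub> A \<otimes>\<^bsub>UT m\<^esub> \<one>\<^bsub>UT m\<^esub> \<in> vanish_on m Z"
      using one by (intro inv_mult_vanish_on Z) (auto simp: vanish_on_def)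
    with A show "inv\<^bsub>UT m\<^esub> A \<in> vanish_on m Z"
      by (auto simp: vanish_on_def simp del: UT_simps)
  next
    fix A B assume A: "A \<in> vanish_on m Z" and B: "B \<in> vanish_on m Z"
    have car: "A \<in> carrier (UT m)" "B \<in> carrier (UT m)" using A B by (auto simp: vanish_on_def)
    have "(A * B) $$ (i, j) = 0" if "(i, j) \<in> Z" for i j
    proof -
      have ij: "i < j" "j < m" using that Z by (auto simp: prec_closed_def strict_upper_def)
      have "B $$ (k, j) = 0" if "k \<in> {i<..<j}" for k
      proof -
        have "(k, j) \<in> strict_upper m" "prec (k, j) (i, j)"
          using that ij by (auto simp: strict_upper_def prec_def)
        with Z \<open>(i, j) \<in> Z\<close> B show ?thesis unfolding prec_closed_def vanish_on_def by blast
      qed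
      then show ?thesis
        using A B that by (simp add: UT_mult_index[OF car ij] vanish_on_def)
    qed
    with car show "A \<otimes>\<^bsub>UT m\<^esub> B \<in> vanish_on m Z"
      using m_closed[OF car] by (auto simp: vanish_on_def)
  qed (use one in \<open>auto simp: vanish_on_def\<close>)
qed

text \<open>For \<open>h\<close> in \<open>vanish_on m Z\<close> the products \<open>g h\<close> and \<open>h g\<close> agree on \<open>Z'\<close>, because the terms with
  a strictly intermediate index vanish in both.\<close>

lemma commutator_vanish_on:
  assumes Z': "prec_closed m Z'"
    and pred: "\<And>p q. q \<in> Z' \<Longrightarrow> p \<in> strict_upper m \<Longrightarrow> prec p q \<Longrightarrow> p \<in> Z"
    and g: "g \<in> carrier (UT m)" and h: "h \<in> vanish_on m Z"
  shows "inv\<^bsub>UT m\<^esub> g \<otimes>\<^bsub>UT m\<^esub> inv\<^bsub>UT m\<^esub> h \<otimes>\<^bsub>UT m\<^esub> g \<otimes>\<^bsub>UT m\<^esub> h \<in> vanish_on m Z'"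
proof -
  interpret group "UT m" by (rule group_UT)
  have h': "h \<in> carrier (UT m)" using h by (simp add: vanish_on_def)
  have "(h * g) $$ (i, j) = (g * h) $$ (i, j)" if "(i, j) \<in> Z'" for i j
  proof -
    have ij: "i < j" "j < m" using that Z' by (auto simp: prec_closed_def strict_upper_def)
    have "h $$ (k, j) = 0" "h $$ (i, k) = 0" if k: "k \<in> {i<..<j}" for k
    proof -
      have "(k, j) \<in> strict_upper m" "prec (k, j) (i, j)" "(i, k) \<in> strict_upper m" "prec (i, k) (i, j)"
        using k ij by (auto simp: strict_upper_def prec_def)
      then have "(k, j) \<in> Z" "(i, k) \<in> Z" using pred[OF \<open>(i, j) \<in> Z'\<close>] by auto
      with h show "h $$ (k, j) = 0" "h $$ (i, k) = 0" unfolding vanish_on_def by auto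
    qed
    then show ?thesis by (simp add: UT_mult_index[OF g h' ij] UT_mult_index[OF h' g ij])
  qed
  \<comment> \<open>The commutator is the quotient of \<open>h g\<close> and \<open>g h\<close>,
    which have just been seen to agree on \<open>Z'\<close>.\<close>
  then have "inv\<^bsub>UT m\<^esub> (h \<otimes>\<^bsub>UT m\<^esub> g) \<otimes>\<^bsub>UT m\<^esub> (g \<otimes>\<^bsub>UT m\<^esub> h) \<in> vanish_on m Z'"
    using m_closed[OF g h'] m_closed[OF h' g] by (intro inv_mult_vanish_on Z') auto
  then show ?thesis
    using g h' by (simp add: inv_mult_group m_assoc del: UT_simps)
qed

lemma normal_vanish_on:
  assumes Z: "prec_closed m Z"
  shows "vanish_on m Z \<lhd> UT m"
proof -
  interpret group "UT m" by (rule group_UT)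
  interpret K: subgroup "vanish_on m Z" "UT m" by (rule subgroup_vanish_on[OF Z])
  show ?thesis
  proof (unfold normal_inv_iff, intro conjI ballI)
    fix g h assume g: "g \<in> carrier (UT m)" and h: "h \<in> vanish_on m Z"
    \<comment> \<open>The commutator of the two inverses is the conjugate of \<open>h\<close> by
      \<open>g\<close> times the inverse of \<open>h\<close>; multiplying by \<open>h\<close> leaves
      the conjugate.\<close>
    have "inv\<^bsub>UT m\<^esub> (inv\<^bsub>UT m\<^esub> g) \<otimes>\<^bsub>UT m\<^esub> inv\<^bsub>UT m\<^esub> (inv\<^bsub>UT m\<^esub> h) \<otimes>\<^bsub>UT m\<^esub> inv\<^bsub>UT m\<^esub> g \<otimes>\<^bsub>UT m\<^esub> inv\<^bsub>UT m\<^esub> h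
        \<in> vanish_on m Z"
      using Z g h by (intro commutator_vanish_on[where Z = Z]) (auto simp: prec_closed_def simp del: UT_simps)
    from K.m_closed[OF this h] show "g \<otimes>\<^bsub>UT m\<^esub> h \<otimes>\<^bsub>UT m\<^esub> inv\<^bsub>UT m\<^esub> g \<in> vanish_on m Z"
      using g K.mem_carrier[OF h] by (simp add: m_assoc del: UT_simps)
  qed (fact subgroup_vanish_on[OF Z])
qed

text \<open>The drop from \<open>Suc k\<close> to \<open>k\<close> is what moves commutators from
  one member of the series into the next.\<close>

lemma prec_take:
  assumes ps: "set ps = strict_upper m" "sorted_wrt prec ps"
    and p: "p \<in> strict_upper m" "prec p q" and q: "q \<in> set (take (Suc k) ps)"
  shows "p \<in> set (take k ps)"
proof -
  obtain b where b: "q = ps ! b" "b < Suc k" "b < length ps"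
    using q by (auto simp: in_set_conv_nth)
  obtain a where a: "p = ps ! a" "a < length ps"
    using p ps by (metis in_set_conv_nth)
  have "a < b"
  proof (rule ccontr)
    assume "\<not> a < b"
    then consider "a = b" | "b < a" by linarith
    then show False
    proof cases
      case 2
      then have "prec q p" using sorted_wrt_nth_less[OF ps(2), of b a] a b by simp
      then show False using p(2) by (auto simp: prec_def)
    qed (use p a b in \<open>auto simp: prec_def\<close>)
  qed
  then show ?thesis using a b by (auto simp: in_set_conv_nth intro!: exI[of _ a])
qed

lemma prec_closed_take:
  assumes "set ps = strict_upper m" "sorted_wrt prec ps"
  shows "prec_closed m (set (take k ps))"
proof -
  have "p \<in> set (take k ps)" if "q \<in> set (take k ps)" "p \<in> strict_upper m" "prec p q" for p q
  proof -
    have "q \<in> set (take (Suc k) ps)"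
      using that set_take_subset_set_take[of k "Suc k" ps] by auto
    with prec_take[OF assms] that show ?thesis by blast
  qed
  then show ?thesis
    using assms set_take_subset[of k ps] by (auto simp: prec_closed_def)
qed

text \<open>A factor with exponent 0 is the identity whatever its base. Thus a product over the
  whole basis can be placed in a subgroup generated by a tail.\<close>

lemma (in group) power_prod_in_subgroup:
  assumes H: "subgroup H G" and len: "length as = length xs"
    and "\<And>k. k < length xs \<Longrightarrow> xs ! k \<noteq> 0 \<Longrightarrow> as ! k \<in> H"
  shows "power_prod G as xs \<in> H"
  using len assms(3)
proof (induction as xs rule: list_induct2)
  case Nil
  then show ?case using H by (simp add: power_prod_def subgroup.one_closed)
next
  case (Cons a as x xs)
  have "a [^] x \<in> H"
  proof (cases "x = 0")
    case True
    then show ?thesis using H by (simp add: subgroup.one_closed)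
  next
    case False
    then show ?thesis using Cons.prems[of 0] H by (simp add: subgroup_int_pow_closed)
  qed
  moreover have "power_prod G as xs \<in> H"
    by (rule Cons.IH) (use Cons.prems[of "Suc _"] in auto)
  ultimately show ?case using H by (simp add: power_prod_def subgroup.m_closed)
qed

text \<open>A generator in the tail has its only nonzero entry above the diagonal outside the first
  \<open>k\<close> positions. Conversely, if \<open>g\<close> vanishes on these, so does its
  inverse, from which the exponents are read off; the first \<open>k\<close> exponents are therefore
  0.\<close>

lemma tail_subgroup_UT:
  assumes ps: "set ps = strict_upper m" "sorted_wrt prec ps"
  shows "tail_subgroup (UT m) (gens m ps) k = vanish_on m (set (take k ps))"
proof -
  interpret group "UT m" by (rule group_UT)
  let ?Z = "set (take k ps)" and ?S = "set (drop k (gens m ps))"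
  have disj: "p \<notin> ?Z" if "p \<in> set (drop k ps)" for p
    using that sorted_wrt_prec_distinct[OF ps(2)] set_take_disj_set_drop_if_distinct[of ps k k] by auto
  have S: "?S \<subseteq> vanish_on m ?Z"
  proof
    fix A assume "A \<in> ?S"
    then obtain p where p: "p \<in> set (drop k ps)" and A: "A = transvection m p 1"
      by (auto simp: drop_map)
    have "p \<in> strict_upper m" using p ps set_drop_subset[of k ps] by auto
    moreover have "A $$ q = 0" if "q \<in> ?Z" for q
    proof -
      have "q \<in> strict_upper m" using that ps set_take_subset[of k ps] by auto
      moreover have "q \<noteq> p" using disj[OF p] that by metis
      ultimately show ?thesis by (auto simp: A strict_upper_def transvection_def)
    qed
    ultimately show "A \<in> vanish_on m ?Z" by (auto simp: vanish_on_def A transvection_UT)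
  qed
  show ?thesis
    unfolding tail_subgroup_def
  proof
    show "generate (UT m) ?S \<subseteq> vanish_on m ?Z"
      using S subgroup_vanish_on[OF prec_closed_take[OF ps]] by (rule generate_subgroup_incl)
  next
    show "vanish_on m ?Z \<subseteq> generate (UT m) ?S"
    proof
      fix g assume g: "g \<in> vanish_on m ?Z"
      then have g': "g \<in> carrier (UT m)" by (simp add: vanish_on_def)
      have gi: "inv\<^bsub>UT m\<^esub> g \<in> vanish_on m ?Z"
        using subgroup.m_inv_closed[OF subgroup_vanish_on[OF prec_closed_take[OF ps]] g] .
      let ?xs = "map (\<lambda>p. - ((inv\<^bsub>UT m\<^esub> g) $$ p)) ps"
      have "g = power_prod (UT m) (gens m ps) ?xs"
        using power_prod_unique[OF ps _ g', of ?xs] by simp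
      also have "\<dots> \<in> generate (UT m) ?S"
      proof (rule power_prod_in_subgroup)
        show "subgroup (generate (UT m) ?S) (UT m)"
          using S by (intro generate_is_subgroup) (auto simp: vanish_on_def)
      next
        fix q assume q: "q < length ?xs" "?xs ! q \<noteq> 0"
        then have "ps ! q \<notin> ?Z" using gi by (auto simp: vanish_on_def)
        then have "k \<le> q"
          using q nth_mem[of q "take k ps"] by (cases "k \<le> q") auto
        then have "gens m ps ! q \<in> ?S"
          using q by (auto simp: in_set_conv_nth intro!: exI[of _ "q - k"])
        then show "gens m ps ! q \<in> generate (UT m) ?S" by (rule generate.incl)
      qed simp
      finally show "g \<in> generate (UT m) ?S" .
    qed
  qed
qed

lemma malcev_basis_UT:
  assumes ps: "set ps = strict_upper m" "sorted_wrt prec ps"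
  shows "malcev_basis (UT m) (gens m ps)"
  unfolding malcev_basis_def tail_subgroup_UT[OF ps]
proof (intro conjI ballI allI impI)
  show "group (UT m)" by (rule group_UT)
  show "set (gens m ps) \<subseteq> carrier (UT m)" using ps by (auto intro: transvection_UT)
  show "\<exists>!xs. length xs = length (gens m ps) \<and> g = power_prod (UT m) (gens m ps) xs"
    if "g \<in> carrier (UT m)" for g
    using power_prod_unique[OF ps _ that] by (intro ex1I[of _ "map (\<lambda>p. - ((inv\<^bsub>UT m\<^esub> g) $$ p)) ps"]) auto
  show "vanish_on m (set (take 0 ps)) = carrier (UT m)" by (auto simp: vanish_on_def)
  show "vanish_on m (set (take k ps)) \<lhd> UT m" for k
    by (rule normal_vanish_on[OF prec_closed_take[OF ps]])
next
  fix k assume "k < length (gens m ps)"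
  then have k: "k < length ps" by simp
  then have p: "ps ! k \<in> strict_upper m" using ps by (metis nth_mem)
  \<comment> \<open>Basis element \<open>k\<close> witnesses strictness: its one nonzero entry above
    the diagonal is at \<open>ps ! k\<close>, the position newly required to vanish.\<close>
  have "transvection m (ps ! k) 1 \<in> vanish_on m (set (take k ps))"
    unfolding tail_subgroup_UT[OF ps, symmetric] tail_subgroup_def
    using k by (intro generate.incl) (auto simp: in_set_conv_nth intro!: exI[of _ 0])
  moreover have "transvection m (ps ! k) 1 \<notin> vanish_on m (set (take (Suc k) ps))"
    using k p by (auto simp: vanish_on_def take_Suc_conv_app_nth transvection_def strict_upper_def)
  moreover have "vanish_on m (set (take (Suc k) ps)) \<subseteq> vanish_on m (set (take k ps))"
    using set_take_subset_set_take[of k "Suc k" ps] by (auto simp: vanish_on_def)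
  ultimately show "vanish_on m (set (take (Suc k) ps)) \<subset> vanish_on m (set (take k ps))" by blast
next
  fix k g h assume "g \<in> carrier (UT m)" "h \<in> vanish_on m (set (take k ps))"
  then show "inv\<^bsub>UT m\<^esub> g \<otimes>\<^bsub>UT m\<^esub> inv\<^bsub>UT m\<^esub> h \<otimes>\<^bsub>UT m\<^esub> g \<otimes>\<^bsub>UT m\<^esub> h \<in> vanish_on m (set (take (Suc k) ps))"
    using prec_take[OF ps] by (intro commutator_vanish_on[OF prec_closed_take[OF ps]]) auto
qed

subsection \<open>Nickel's module\<close>

definition inv_entry :: "nat \<Rightarrow> nat \<times> nat \<Rightarrow> int mat \<Rightarrow> rat" where
  "inv_entry m p = (\<lambda>h. if h \<in> carrier (UT m) then - of_int ((inv\<^bsub>UT m\<^esub> h) $$ p) else 0)"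

lemma coord_fun_UT:
  assumes "set ps = strict_upper m" "sorted_wrt prec ps" "k < length ps"
  shows "coord_fun (UT m) (gens m ps) k = inv_entry m (ps ! k)"
  using assms by (auto simp: coord_fun_def inv_entry_def malcev_exponents_UT fun_eq_iff)

lemma coord_funs_UT:
  assumes "set ps = strict_upper m" "sorted_wrt prec ps"
  shows "{coord_fun (UT m) (gens m ps) k | k. k < length (gens m ps)} = inv_entry m ` strict_upper m"
proof -
  have "{coord_fun (UT m) (gens m ps) k | k. k < length (gens m ps)}
      = (\<lambda>k. coord_fun (UT m) (gens m ps) k) ` {..<length ps}" by auto
  also have "\<dots> = (\<lambda>k. inv_entry m (ps ! k)) ` {..<length ps}"
    using coord_fun_UT[OF assms] by (intro image_cong) auto
  also have "\<dots> = inv_entry m ` (\<lambda>k. ps ! k) ` {..<length ps}" by (simp only: image_image)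
  also have "(\<lambda>k. ps ! k) ` {..<length ps} = strict_upper m"
    unfolding assms(1)[symmetric] by (auto simp: set_conv_nth)
  finally show ?thesis .
qed

lemma dual_act_inv_entry:
  assumes g: "g \<in> carrier (UT m)" and ij: "i < m" "j < m"
  shows "dual_act (UT m) (inv_entry m (i, j)) g =
    (\<lambda>h. \<Sum>k<m. of_int (g $$ (i, k)) * inv_entry m (k, j) h)"
proof
  interpret group "UT m" by (rule group_UT)
  fix h
  show "dual_act (UT m) (inv_entry m (i, j)) g h = (\<Sum>k<m. of_int (g $$ (i, k)) * inv_entry m (k, j) h)"
  proof (cases "h \<in> carrier (UT m)")
    case h: True
    have "inv\<^bsub>UT m\<^esub> (h \<otimes>\<^bsub>UT m\<^esub> inv\<^bsub>UT m\<^esub> g) = g \<otimes>\<^bsub>UT m\<^esub> inv\<^bsub>UT m\<^esub> h"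
      using g h by (simp add: inv_mult_group del: UT_simps)
    also have "\<dots> $$ (i, j) = (\<Sum>k<m. g $$ (i, k) * (inv\<^bsub>UT m\<^esub> h) $$ (k, j))"
      using g inv_closed[OF h] ij by (simp add: index_mult_mat_sum[of _ m] UT_carrier_mat)
    finally show ?thesis
      using m_closed[OF h inv_closed[OF g]] h by (simp add: dual_act_def inv_entry_def sum_negf)
  qed (simp add: dual_act_def inv_entry_def)
qed

lemma inv_entry_diag: "i < m \<Longrightarrow> j < m \<Longrightarrow> inv_entry m (i, i) = inv_entry m (j, j)"
  by (auto simp: inv_entry_def UT_diag[OF UT_inv_closed] fun_eq_iff)

lemma inv_entry_lower: "j < i \<Longrightarrow> i < m \<Longrightarrow> inv_entry m (i, j) = 0"
  by (auto simp: inv_entry_def UT_lower[OF UT_inv_closed] fun_eq_iff)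

lemma inv_entry_inv:
  "A \<in> carrier (UT m) \<Longrightarrow> inv_entry m p (inv\<^bsub>UT m\<^esub> A) = - of_int (A $$ p)"
  using group.inv_closed[OF group_UT] group.inv_inv[OF group_UT] by (simp add: inv_entry_def)

lemma sum_rat_scale: "(\<Sum>k\<in>K. rat_scale (c k) (f k)) = (\<lambda>h. \<Sum>k\<in>K. c k * f k h)"
proof
  fix h
  show "(\<Sum>k\<in>K. rat_scale (c k) (f k)) h = (\<Sum>k\<in>K. c k * f k h)"
    by (induction K rule: infinite_finite_induct) (auto simp: rat_scale_def)
qed

section \<open>A basis of the module\<close>

lemma subspace_zero_functional:
  "rat_fun.subspace {f. f x = f y}" "rat_fun.subspace {f. f x = 0}"
  by (auto simp: rat_fun.subspace_def rat_scale_def)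

text \<open>For \<open>m > 0\<close> the function \<open>inv_entry m (0, 0)\<close> is -1 on the
  whole group and stands for the constants.\<close>

definition inv_basis :: "nat \<Rightarrow> (int mat \<Rightarrow> rat) set" where
  "inv_basis m = insert (inv_entry m (0, 0)) (inv_entry m ` strict_upper m)"

text \<open>Inverses of the basis elements serve as test points, since evaluation there undoes the
  inversion inside \<open>inv_entry\<close>: the values form a negated identity matrix.\<close>

lemma inv_entry_transvection:
  assumes "p \<in> strict_upper m" "q \<in> strict_upper m"
  shows "inv_entry m q (inv\<^bsub>UT m\<^esub> (transvection m p 1)) = - of_bool (q = p)"
  by (simp add: inv_entry_inv[OF transvection_UT[OF assms(1)]] transvection_strict_upper[OF assms(2)])

lemma inv_entry_one:
  assumes "q \<in> strict_upper m"
  shows "inv_entry m q (1\<^sub>m m) = 0"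
  using assms by (auto simp: inv_entry_def UT_one_closed UT_inv_one strict_upper_def)

lemma inv_entry_00:
  assumes "A \<in> carrier (UT m)" "m > 0"
  shows "inv_entry m (0, 0) A = - 1"
  using assms by (simp add: inv_entry_def UT_diag[OF UT_inv_closed])

text \<open>Each member is separated from the others by a subspace, the kernel of a linear
  functional, that contains all of them but not it.\<close>

lemma independent_inv_basis:
  assumes m: "m > 0"
  shows "rat_fun.independent (inv_basis m)"
proof -
  interpret group "UT m" by (rule group_UT)
  have "a \<notin> rat_fun.span (inv_basis m - {a})" if "a \<in> inv_basis m" for a
  proof -
    consider "a = inv_entry m (0, 0)" | p where "p \<in> strict_upper m" "a = inv_entry m p"
      using \<open>a \<in> inv_basis m\<close> by (auto simp: inv_basis_def)
    then have "\<exists>W. rat_fun.subspace W \<and> inv_basis m - {a} \<subseteq> W \<and> a \<notin> W"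
    proof cases
      case 1
      \<comment> \<open>Evaluation at the identity kills every coordinate function but not the
        constant.\<close>
      then show ?thesis
        using m UT_one_closed subspace_zero_functional(2)[of "1\<^sub>m m"]
        by (intro exI[of _ "{f. f (1\<^sub>m m) = 0}"]) (auto simp: inv_basis_def inv_entry_one inv_entry_00)
    next
      case (2 p)
      \<comment> \<open>The difference of the values at \<open>?x\<close> and at the identity kills
        the constant and every coordinate function except the one at \<open>p\<close>.\<close>
      let ?x = "inv\<^bsub>UT m\<^esub> (transvection m p 1)"
      have "?x \<in> carrier (UT m)" using transvection_UT[OF 2(1)] by (rule inv_closed)
      then show ?thesis
        using m UT_one_closed 2 subspace_zero_functional(1)[of ?x "1\<^sub>m m"]
        by (intro exI[of _ "{f. f ?x = f (1\<^sub>m m)}"])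
          (auto simp: inv_basis_def inv_entry_one inv_entry_00 inv_entry_transvection)
    qed
    then show ?thesis using rat_fun.span_minimal by blast
  qed
  then show ?thesis by (auto simp: rat_fun.dependent_def)
qed

lemma card_inv_basis:
  assumes m: "m > 0"
  shows "card (inv_basis m) = m * (m - 1) div 2 + 1"
proof -
  have "inj_on (inv_entry m) (strict_upper m)"
  proof (rule inj_onI)
    fix p q assume pq: "p \<in> strict_upper m" "q \<in> strict_upper m" "inv_entry m p = inv_entry m q"
    have "- of_bool (p = p) = (- of_bool (q = p) :: rat)"
      using inv_entry_transvection[OF pq(1,1)] inv_entry_transvection[OF pq(1,2)] pq(3) by metis
    then show "p = q" by (cases "q = p") auto
  qed
  moreover have "inv_entry m (0, 0) \<notin> inv_entry m ` strict_upper m"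
  proof
    assume "inv_entry m (0, 0) \<in> inv_entry m ` strict_upper m"
    then obtain p where "p \<in> strict_upper m" "inv_entry m (0, 0) = inv_entry m p" by auto
    then show False
      using inv_entry_00[OF UT_one_closed m] inv_entry_one by simp
  qed
  ultimately show ?thesis
    by (simp add: inv_basis_def finite_strict_upper card_image card_strict_upper)
qed

text \<open>The action formula sums over a whole column; positions on or below the diagonal add only
  a constant or 0.\<close>

lemma inv_entry_in_span:
  assumes "i < m" "j < m"
  shows "inv_entry m (i, j) \<in> rat_fun.span (inv_basis m)"
proof -
  consider "i < j" | "i = j" | "j < i" by linarith
  then show ?thesis
  proof cases
    case 1
    then show ?thesis using assms by (intro rat_fun.span_base) (auto simp: inv_basis_def strict_upper_def)
  next
    case 2
    then have "inv_entry m (i, j) = inv_entry m (0, 0)" using assms inv_entry_diag[of i m 0] by simp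
    then show ?thesis by (auto intro: rat_fun.span_base simp: inv_basis_def)
  next
    case 3
    then show ?thesis using assms by (simp add: inv_entry_lower rat_fun.span_zero)
  qed
qed

section \<open>The span as the generated submodule\<close>

lemma dual_submodule_span_inv_basis:
  assumes m: "m > 0"
  shows "dual_submodule (UT m) (rat_fun.span (inv_basis m))"
  unfolding dual_submodule_def
proof (intro conjI ballI)
  have "rat_fun.subspace (dual_space (UT m))"
    by (auto simp: dual_space_def rat_fun.subspace_def rat_scale_def)
  moreover have "inv_basis m \<subseteq> dual_space (UT m)"
    by (auto simp: inv_basis_def dual_space_def inv_entry_def)
  ultimately show "rat_fun.span (inv_basis m) \<subseteq> dual_space (UT m)"
    by (intro rat_fun.span_minimal)
next
  fix g f assume g: "g \<in> carrier (UT m)" and f: "f \<in> rat_fun.span (inv_basis m)"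
  \<comment> \<open>The functions that \<open>g\<close> sends into the span form a subspace, so
    stability has to be checked on \<open>inv_basis m\<close> only.\<close>
  let ?W = "{f. dual_act (UT m) f g \<in> rat_fun.span (inv_basis m)}"
  have "dual_act (UT m) 0 g = 0"
    "dual_act (UT m) (f1 + f2) g = dual_act (UT m) f1 g + dual_act (UT m) f2 g"
    "dual_act (UT m) (rat_scale c f1) g = rat_scale c (dual_act (UT m) f1 g)" for c f1 f2
    by (auto simp: dual_act_def rat_scale_def fun_eq_iff)
  then have "rat_fun.subspace ?W"
    by (auto simp: rat_fun.subspace_def rat_fun.span_zero rat_fun.span_add rat_fun.span_scale)
  moreover have "inv_entry m (i, j) \<in> ?W" if "i < m" "j < m" for i j
    using that inv_entry_in_span
    by (auto simp: dual_act_inv_entry[OF g] sum_rat_scale[symmetric] intro!: rat_fun.span_sum rat_fun.span_scale)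
  then have "inv_basis m \<subseteq> ?W" using m by (auto simp: inv_basis_def strict_upper_def)
  ultimately show "dual_act (UT m) f g \<in> rat_fun.span (inv_basis m)"
    using rat_fun.span_minimal[of "inv_basis m" ?W] f by auto
qed (rule rat_fun.subspace_span)

text \<open>The action of \<open>s\<^sub>1\<^sub>2\<close> changes its own coordinate function by a constant.\<close>

lemma inv_entry_00_in_submodule:
  assumes m: "m \<ge> 2" and V: "dual_submodule (UT m) V" and t: "inv_entry m (0, 1) \<in> V"
  shows "inv_entry m (0, 0) \<in> V"
proof -
  have p: "(0, 1) \<in> strict_upper m" using m by (simp add: strict_upper_def)
  have m': "0 < m" "1 < m" using m by auto
  let ?g = "transvection m (0, 1) 1"
  have g: "?g \<in> carrier (UT m)" by (rule transvection_UT[OF p])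
  have row: "of_int (?g $$ (0, k)) = (of_bool (k = 0) + of_bool (k = 1) :: rat)" if "k < m" for k
    using that m by (auto simp: transvection_def)
  have "dual_act (UT m) (inv_entry m (0, 1)) ?g h = inv_entry m (0, 1) h + inv_entry m (0, 0) h" for h
  proof -
    have "dual_act (UT m) (inv_entry m (0, 1)) ?g h
        = (\<Sum>k<m. (of_bool (k = 0) + of_bool (k = 1)) * inv_entry m (k, 1) h)"
      unfolding dual_act_inv_entry[OF g m'] using row by (intro sum.cong) auto
    also have "\<dots> = (\<Sum>k\<in>{0, 1}. (of_bool (k = 0) + of_bool (k = 1)) * inv_entry m (k, 1) h)"
      using m by (intro sum.mono_neutral_right) auto
    also have "\<dots> = inv_entry m (0, 1) h + inv_entry m (1, 1) h" by simp
    \<comment> \<open>The term \<open>k = 1\<close> comes from the diagonal position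
      \<open>(1, 1)\<close>, which gives the same constant as \<open>(0, 0)\<close>.\<close>
    finally show ?thesis using inv_entry_diag[of 1 m 0] m by simp
  qed
  then have "inv_entry m (0, 0) = dual_act (UT m) (inv_entry m (0, 1)) ?g - inv_entry m (0, 1)"
    by (auto simp: fun_eq_iff)
  moreover have "dual_act (UT m) (inv_entry m (0, 1)) ?g \<in> V" and "rat_fun.subspace V"
    using V g t by (auto simp: dual_submodule_def)
  ultimately show ?thesis using t by (simp add: rat_fun.subspace_diff)
qed

text \<open>Minimality: a submodule containing the coordinate functions contains the one at
  \<open>(0, 1)\<close>, a position that exists as \<open>m \<ge> 2\<close>. The action on it forces
  the constants in as well, hence the whole span.\<close>

lemma nickel_module_UT:
  assumes m: "m \<ge> 2" and ps: "set ps = strict_upper m" "sorted_wrt prec ps"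
  shows "nickel_module (UT m) (gens m ps) = rat_fun.span (inv_basis m)"
  unfolding nickel_module_def coord_funs_UT[OF ps]
proof (rule hull_unique)
  show "inv_entry m ` strict_upper m \<subseteq> rat_fun.span (inv_basis m)"
    by (auto simp: inv_basis_def intro: rat_fun.span_base)
  show "dual_submodule (UT m) (rat_fun.span (inv_basis m))"
    using m by (intro dual_submodule_span_inv_basis) simp
next
  fix V assume V: "inv_entry m ` strict_upper m \<subseteq> V" "dual_submodule (UT m) V"
  have "inv_entry m (0, 1) \<in> V" using V(1) m by (auto simp: strict_upper_def)
  then have "inv_basis m \<subseteq> V"
    using inv_entry_00_in_submodule[OF m V(2)] V(1) by (simp add: inv_basis_def)
  then show "rat_fun.span (inv_basis m) \<subseteq> V"
    using V(2) by (intro rat_fun.span_minimal) (auto simp: dual_submodule_def)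
qed

lemma nickel_dim_UT:
  assumes "m \<ge> 2" "set ps = strict_upper m" "sorted_wrt prec ps"
  shows "nickel_dim (UT m) (gens m ps) = m * (m - 1) div 2 + 1"
  unfolding nickel_dim_def nickel_module_UT[OF assms]
  using assms(1) independent_inv_basis card_inv_basis by (simp add: rat_fun.dim_eq_card_independent)

section \<open>From the prescribed ordering to the sorted list of positions\<close>

theorem mainTheorem3:
  fixes m n :: nat and as :: "int mat list"
  assumes "m \<ge> 2"
    and "n = m * (m - 1) div 2"
    and "length as = n"
    and "set as = {s_mat m i j | i j. 1 \<le> i \<and> i < j \<and> j \<le> m}"
    and "\<And>p q i j k l.
           \<lbrakk>p < n; q < n; 1 \<le> i; i < j; j \<le> m; 1 \<le> k; k < l; l \<le> m;
            as ! p = s_mat m i j; as ! q = s_mat m k l\<rbrakk>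
           \<Longrightarrow> p < q \<longleftrightarrow> j < l \<or> (j = l \<and> i > k)"
  shows "malcev_basis (UT m) as \<and> nickel_dim (UT m) as = n + 1"
proof -
  let ?f = "\<lambda>p. transvection m p 1"
  have inj: "inj_on ?f (strict_upper m)"
  proof (rule inj_onI)
    fix p q assume pq: "p \<in> strict_upper m" "q \<in> strict_upper m" "?f p = ?f q"
    have "1 * of_bool (q = p) = (1 * of_bool (q = q) :: int)"
      using transvection_strict_upper[OF pq(2), of p 1] transvection_strict_upper[OF pq(2), of q 1] pq(3) by metis
    then show "p = q" by (cases "q = p") auto
  qed
  have "set as = ?f ` strict_upper m"
  proof -
    have "s_mat m i j \<in> ?f ` strict_upper m" if "1 \<le> i" "i < j" "j \<le> m" for i j
      using that s_mat_Suc[of m "i - 1" "j - 1"] by (auto simp: strict_upper_def intro!: image_eqI)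
    moreover have "?f p \<in> {s_mat m i j | i j. 1 \<le> i \<and> i < j \<and> j \<le> m}" if "p \<in> strict_upper m" for p
    proof -
      obtain i j where "p = (i, j)" by fastforce
      then have "?f p = s_mat m (Suc i) (Suc j)" "i < j" "j < m"
        using that by (simp_all add: s_mat_Suc strict_upper_def)
      then show ?thesis by fastforce
    qed
    ultimately show ?thesis unfolding assms(4) by blast
  qed
  \<comment> \<open>A list of elementary matrices is the image of a list of positions, and
    injectivity forces these to be all positions above the diagonal.\<close>
  then have "as \<in> lists (?f ` strict_upper m)" by auto
  then obtain ps where as: "as = gens m ps" and "set ps \<subseteq> strict_upper m"
    unfolding lists_image by auto
  with inj \<open>set as = ?f ` strict_upper m\<close> have ps: "set ps = strict_upper m"
    using inj_on_image_eq_iff[OF inj, of "set ps" "strict_upper m"] by auto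
  have "sorted_wrt prec ps"
    unfolding sorted_wrt_iff_nth_less
  proof (intro allI impI)
    fix p q assume pq: "p < q" "q < length ps"
    obtain i j k l where ijkl: "ps ! p = (i, j)" "ps ! q = (k, l)" by fastforce
    have "(i, j) \<in> strict_upper m" "(k, l) \<in> strict_upper m"
      using pq ps ijkl by (metis nth_mem order.strict_trans)+
    \<comment> \<open>Adding 1 to all four indices passes to the indexing of the hypothesis without
      changing any comparison.\<close>
    then have "j < l \<or> j = l \<and> i > k"
      using assms(5)[of p q "Suc i" "Suc j" "Suc k" "Suc l"] pq ijkl assms(3)
      by (auto simp: as s_mat_Suc strict_upper_def)
    then show "prec (ps ! p) (ps ! q)" by (simp add: ijkl prec_def)
  qed
  with ps show ?thesis
    using malcev_basis_UT nickel_dim_UT[OF assms(1)] assms(2) as by simp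
qed

end
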